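(* Let $X$ and $Y$ be two GGCs with Thorin measures $\mu_X$ and $\mu_Y$. Then $X\leq_{\mathrm{Lt}}Y$ if and only if $\mu_X\leq_{\mathrm S}\mu_Y$.
   Context: A GGC (generalized gamma convolution) here is a nonnegative random variable $X$ with $\mathbb{E}[e^{-sX}]=\exp\left(-\int_0^\infty\log(1+s/u)\,\mu(du)\right)$ for $s\ge0$, where $\mu$ (the Thorin measure of $X$) is a nonzero nonnegative measure on $(0,\infty)$ with $\int_{(0,1]}|\log u|\,\mu(du)+\int_{(1,\infty)}u^{-1}\,\mu(du)<\infty$. Laplace transform order: for nonnegative random variables, $X\leq_{\mathrm{Lt}}Y$ means $\mathbb{E}[e^{-\rho X}]\ge\mathbb{E}[e^{-\rho Y}]$ for all $\rho\ge0$. Shannon transform order: for nonnegative measures $\mu_1,\mu_2$ on $(0,\infty)$ whose Shannon transforms $\int_0^\infty\log(1+\rho/s)\,\mu_i(ds)$ are finite for all $\rho\ge0$, $\mu_1\leq_{\mathrm S}\mu_2$ means $\int_0^\infty\log(1+\rho/s)\,\mu_1(ds)\le\int_0^\infty\log(1+\rho/s)\,\mu_2(ds)$ for all $\rho\ge0$. *)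

theory Defs
  imports "HOL-Probability.Probability"
begin

text \<open>The function \<open>x \<mapsto> e\<^sup>-\<^sup>x\<close> on \<open>[0, \<infinity>]\<close>, with \<open>e\<^sup>-\<^sup>\<infinity> = 0\<close>.\<close>

definition exp_neg :: "ennreal \<Rightarrow> real" where
  "exp_neg x = (if x = \<infinity> then 0 else exp (- enn2real x))"

lemma exp_neg_ennreal: "0 \<le> x \<Longrightarrow> exp_neg (ennreal x) = exp (- x)"
  by (simp add: exp_neg_def)

definition measure_on_pos :: "real measure \<Rightarrow> bool" where
  "measure_on_pos \<mu> \<longleftrightarrow> sets \<mu> = sets (restrict_space borel {0<..})"

text \<open>The integrand is nonnegative for \<open>\<rho> \<ge> 0\<close>, so the nonnegative integral is the usual one; an
  infinite value is kept as \<open>\<infinity>\<close>, where the Bochner integral would return 0.\<close>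

definition shannon_transform :: "real measure \<Rightarrow> real \<Rightarrow> ennreal" where
  "shannon_transform \<mu> \<rho> = (\<integral>\<^sup>+ s. ennreal (ln (1 + \<rho> / s)) \<partial>\<mu>)"

definition shannon_le :: "real measure \<Rightarrow> real measure \<Rightarrow> bool"  (infix "\<le>\<^sub>S" 50) where
  "\<mu>\<^sub>1 \<le>\<^sub>S \<mu>\<^sub>2 \<longleftrightarrow>
     measure_on_pos \<mu>\<^sub>1 \<and> measure_on_pos \<mu>\<^sub>2 \<and>
     (\<forall>\<rho>\<ge>0. shannon_transform \<mu>\<^sub>1 \<rho> < \<infinity> \<and> shannon_transform \<mu>\<^sub>2 \<rho> < \<infinity>) \<and>
     (\<forall>\<rho>\<ge>0. shannon_transform \<mu>\<^sub>1 \<rho> \<le> shannon_transform \<mu>\<^sub>2 \<rho>)"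

definition nonneg_random_variable :: "'a measure \<Rightarrow> ('a \<Rightarrow> real) \<Rightarrow> bool" where
  "nonneg_random_variable M X \<longleftrightarrow>
     prob_space M \<and> X \<in> borel_measurable M \<and> (AE \<omega> in M. 0 \<le> X \<omega>)"

definition laplace_transform :: "'a measure \<Rightarrow> ('a \<Rightarrow> real) \<Rightarrow> real \<Rightarrow> real" where
  "laplace_transform M X s = (\<integral>\<omega>. exp (- s * X \<omega>) \<partial>M)"

text \<open>The order compares distributions only, so the two variables may live on different
  probability spaces.\<close>

definition laplace_le ::
  "'a measure \<Rightarrow> ('a \<Rightarrow> real) \<Rightarrow> 'b measure \<Rightarrow> ('b \<Rightarrow> real) \<Rightarrow> bool" where
  "laplace_le M X N Y \<longleftrightarrow>
     nonneg_random_variable M X \<and> nonneg_random_variable N Y \<and>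
     (\<forall>\<rho>\<ge>0. laplace_transform M X \<rho> \<ge> laplace_transform N Y \<rho>)"

definition thorin_measure :: "real measure \<Rightarrow> bool" where
  "thorin_measure \<mu> \<longleftrightarrow>
     measure_on_pos \<mu> \<and> emeasure \<mu> (space \<mu>) \<noteq> 0 \<and>
     (\<integral>\<^sup>+ u\<in>{0<..1}. ennreal \<bar>ln u\<bar> \<partial>\<mu>) + (\<integral>\<^sup>+ u\<in>{1<..}. ennreal (1 / u) \<partial>\<mu>) < \<infinity>"

text \<open>\<open>GGC M X \<mu>\<close>: the variable \<open>X\<close> on \<open>M\<close> is a generalized gamma convolution with Thorin
  measure \<open>\<mu>\<close>. The exponent is the Shannon transform of \<open>\<mu>\<close>. The integrability condition does not
  force it to be finite (\<open>\<mu>\<close> may have infinite mass near 1, where \<open>ln u\<close> vanishes); finiteness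
  comes from positivity of the Laplace transform and the convention \<open>e\<^sup>-\<^sup>\<infinity> = 0\<close>.\<close>

definition GGC :: "'a measure \<Rightarrow> ('a \<Rightarrow> real) \<Rightarrow> real measure \<Rightarrow> bool" where
  "GGC M X \<mu> \<longleftrightarrow>
     nonneg_random_variable M X \<and> thorin_measure \<mu> \<and>
     (\<forall>s\<ge>0. laplace_transform M X s = exp_neg (\<integral>\<^sup>+ u. ennreal (ln (1 + s / u)) \<partial>\<mu>))"

end

theory Submission
  imports Defs
begin

text \<open>For a GGC the Laplace transform at \<open>s\<close> is \<open>exp_neg\<close> of the
  Shannon transform of its Thorin measure at \<open>s\<close>. As \<open>exp_neg\<close> is strictly
  decreasing (\<open>exp_neg_le_iff\<close>), the two orders reverse into each other pointwise in
  the argument. Beyond this, \<open>shannon_le\<close> demands finite Shannon transforms;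
  \<open>GGC_shannon_transform_finite\<close> gets this from \<open>laplace_transform_pos\<close>,
  because \<open>exp_neg\<close> vanishes only at infinity.\<close>

lemma laplace_transform_pos:
  assumes "nonneg_random_variable M X" and "0 \<le> s"
  shows "0 < laplace_transform M X s"
proof -
  interpret prob_space M
    using assms(1) by (simp add: nonneg_random_variable_def)
  have [measurable]: "X \<in> borel_measurable M" and nonneg: "AE \<omega> in M. 0 \<le> X \<omega>"
    using assms(1) by (simp_all add: nonneg_random_variable_def)
  \<comment> \<open>Integrability must come first: the Bochner integral of a non-integrable function
    is 0, which would break strict positivity.\<close>
  have "AE \<omega> in M. norm (exp (- s * X \<omega>)) \<le> 1"
    using nonneg by eventually_elim (use assms(2) in simp)
  then have "integrable M (\<lambda>\<omega>. exp (- s * X \<omega>))"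
    by (intro integrable_const_bound[where B = 1]) simp_all
  \<comment> \<open>A pointwise strict inequality stays strict after integration because the whole
    space has measure 1, hence is not null.\<close>
  then have "(\<integral>\<omega>. 0 \<partial>M) < (\<integral>\<omega>. exp (- s * X \<omega>) \<partial>M)"
    by (intro integral_less_AE_space) (simp_all add: emeasure_space_1)
  then show ?thesis
    by (simp add: laplace_transform_def)
qed

lemma exp_neg_pos_iff: "0 < exp_neg x \<longleftrightarrow> x < \<infinity>"
  by (simp add: exp_neg_def less_top)

lemma exp_neg_le_iff:
  assumes "x < \<infinity>" and "y < \<infinity>"
  shows "exp_neg y \<le> exp_neg x \<longleftrightarrow> x \<le> y"
  using assms by (cases x; cases y) (simp_all add: exp_neg_ennreal)

lemma GGC_laplace_transform:
  assumes "GGC M X \<mu>" and "0 \<le> s"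
  shows "laplace_transform M X s = exp_neg (shannon_transform \<mu> s)"
  using assms by (simp add: GGC_def shannon_transform_def)

text \<open>Finiteness is forced by the random variable itself: an infinite exponent would make its
  Laplace transform 0.\<close>

lemma GGC_shannon_transform_finite:
  assumes "GGC M X \<mu>" and "0 \<le> s"
  shows "shannon_transform \<mu> s < \<infinity>"
proof -
  have "0 < laplace_transform M X s"
    using assms by (intro laplace_transform_pos) (simp_all add: GGC_def)
  then show ?thesis
    using assms by (simp add: GGC_laplace_transform exp_neg_pos_iff)
qed

theorem proposition5:
  fixes M :: "'a measure" and N :: "'b measure"
    and X :: "'a \<Rightarrow> real" and Y :: "'b \<Rightarrow> real"
    and \<mu>\<^sub>X \<mu>\<^sub>Y :: "real measure"
  assumes "GGC M X \<mu>\<^sub>X" and "GGC N Y \<mu>\<^sub>Y"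
  shows "laplace_le M X N Y \<longleftrightarrow> \<mu>\<^sub>X \<le>\<^sub>S \<mu>\<^sub>Y"
proof -
  have "laplace_transform N Y \<rho> \<le> laplace_transform M X \<rho> \<longleftrightarrow>
      shannon_transform \<mu>\<^sub>X \<rho> \<le> shannon_transform \<mu>\<^sub>Y \<rho>" if "0 \<le> \<rho>" for \<rho>
    using assms that
    by (simp only: GGC_laplace_transform exp_neg_le_iff GGC_shannon_transform_finite)
  moreover have "nonneg_random_variable M X" "nonneg_random_variable N Y"
      "measure_on_pos \<mu>\<^sub>X" "measure_on_pos \<mu>\<^sub>Y"
    using assms by (simp_all add: GGC_def thorin_measure_def)
  ultimately show ?thesis
    \<comment> \<open>Supplies the finiteness clause of \<open>shannon_le\<close>, which the
      pointwise equivalence does not cover.\<close>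
    using assms[THEN GGC_shannon_transform_finite]
    by (simp add: laplace_le_def shannon_le_def)
qed

end
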